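(* Let $0<p<\infty$. Let $\theta$ be an inner function whose Blaschke component is $B=\gamma\prod_{i=1}^nB_{a_i}^{m_i}$ with $n>1$, $\gamma$ a unimodular constant, $a_1,\dots,a_n\in\mathbb{D}$ distinct, and multiplicities $m_i\ge1$ ordered so that $m_1\le m_2\le\cdots\le m_n$. Suppose that $m_{n-2}<m_{n-1}<m_n$ (in case $n=2$: $m_1<m_2$). Then $\theta H^p$ is not invariant under $C_\phi$ for any nontrivial (i.e. non-identity) disk automorphism $\phi$.
   Context: For $a\in\mathbb{D}$ (the open unit disk), $B_a(z)=\frac{a-z}{1-\overline{a}z}$. An inner function is a bounded holomorphic function on $\mathbb{D}$ with radial limits of modulus $1$ a.e. on the unit circle; it factors, uniquely up to unimodular constants, as $\theta=BS$ with $B$ a Blaschke product (the Blaschke component) and $S$ a singular (non-vanishing) inner function. $H^p$ is the Hardy space on $\mathbb{D}$, $\theta H^p=\{\theta f:f\in H^p\}$, $C_\phi(f)=f\circ\phi$, and invariance means $C_\phi(\theta H^p)\subseteq\theta H^p$. *)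

theory Defs
  imports "HOL-Complex_Analysis.Complex_Analysis"
begin

text \<open>
  Functions on the unit disk are total functions on \<open>complex\<close>; all notions below depend only
  on their values on \<open>ball 0 1\<close>.
\<close>

definition blaschke_factor :: "complex \<Rightarrow> complex \<Rightarrow> complex" where
  "blaschke_factor a z = (a - z) / (1 - cnj a * z)"

definition inner_function :: "(complex \<Rightarrow> complex) \<Rightarrow> bool" where
  "inner_function \<theta> \<longleftrightarrow>
     \<theta> holomorphic_on ball 0 1 \<and> bounded (\<theta> ` ball 0 1) \<and>
     (AE t in lebesgue_on {0..2*pi}.
        \<exists>l. cmod l = 1 \<and> ((\<lambda>r. \<theta> (of_real r * cis t)) \<longlongrightarrow> l) (at_left 1))"

definition singular_inner :: "(complex \<Rightarrow> complex) \<Rightarrow> bool" where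
  "singular_inner S \<longleftrightarrow> inner_function S \<and> (\<forall>z\<in>ball 0 1. S z \<noteq> 0)"

text \<open>
  The zeros, repeated according to multiplicity, are \<open>c i\<close> for \<open>i \<in> I\<close>; the set \<open>I\<close> may be
  empty, finite or infinite.  The unimodular constants \<open>\<bar>c i\<bar> / c i\<close> (read as \<open>1\<close> if \<open>c i = 0\<close>)
  make the infinite product converge under the summability condition.
\<close>
definition blaschke_product :: "(complex \<Rightarrow> complex) \<Rightarrow> bool" where
  "blaschke_product B \<longleftrightarrow>
     (\<exists>\<gamma> I c. cmod \<gamma> = 1 \<and> (\<forall>i\<in>I. c i \<in> ball 0 1) \<and>
        summable (\<lambda>i::nat. if i \<in> I then 1 - cmod (c i) else 0) \<and>
        (\<forall>z\<in>ball 0 1. B z = \<gamma> * (\<Prod>i. if i \<in> I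
            then (if c i = 0 then 1 else of_real (cmod (c i)) / c i) * blaschke_factor (c i) z
            else 1)))"

definition blaschke_component :: "(complex \<Rightarrow> complex) \<Rightarrow> (complex \<Rightarrow> complex) \<Rightarrow> bool" where
  "blaschke_component \<theta> B \<longleftrightarrow>
     blaschke_product B \<and> (\<exists>S. singular_inner S \<and> (\<forall>z\<in>ball 0 1. \<theta> z = B z * S z))"

definition hardy_space :: "real \<Rightarrow> (complex \<Rightarrow> complex) set" where
  "hardy_space p = {f. f holomorphic_on ball 0 1 \<and>
     bdd_above ((\<lambda>r. 1 / (2 * pi) *
       integral {0..2*pi} (\<lambda>t. cmod (f (of_real r * cis t)) powr p)) ` {0..<1})}"

text \<open>Equality with \<open>\<theta> f\<close> is required on the disk only, so that values elsewhere cannot affect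
  the invariance of \<open>\<theta> H\<^sup>p\<close>.\<close>
definition mult_hardy :: "(complex \<Rightarrow> complex) \<Rightarrow> real \<Rightarrow> (complex \<Rightarrow> complex) set" where
  "mult_hardy \<theta> p = {g. \<exists>f\<in>hardy_space p. \<forall>z\<in>ball 0 1. g z = \<theta> z * f z}"

definition composition_op :: "(complex \<Rightarrow> complex) \<Rightarrow> (complex \<Rightarrow> complex) \<Rightarrow> complex \<Rightarrow> complex" where
  "composition_op \<phi> f = f \<circ> \<phi>"

definition disk_automorphism :: "(complex \<Rightarrow> complex) \<Rightarrow> bool" where
  "disk_automorphism \<phi> \<longleftrightarrow> \<phi> holomorphic_on ball 0 1 \<and> bij_betw \<phi> (ball 0 1) (ball 0 1)"

lemma blaschke_product_finite:
  fixes a :: "nat \<Rightarrow> complex"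
  assumes "cmod \<gamma> = 1" and a: "\<forall>i\<in>{1..n}. a i \<in> ball 0 1"
  shows "blaschke_product (\<lambda>z. \<gamma> * (\<Prod>i=1..n. blaschke_factor (a i) z ^ m i))"
proof -
  define xs where "xs = concat (map (\<lambda>i. replicate (m i) (a i)) [1..<Suc n])"
  define u where "u = (\<lambda>c::complex. if c = 0 then 1 else of_real (cmod c) / c)"
  define I where "I = {..<length xs}"
  have u: "cmod (u c) = 1" for c by (simp add: u_def norm_divide)
  have xs: "set xs \<subseteq> ball 0 1" using a by (auto simp: xs_def)
  define \<gamma>' where "\<gamma>' = \<gamma> / (\<Prod>i\<in>I. u (xs ! i))"
  have nz: "(\<Prod>i\<in>I. u (xs ! i)) \<noteq> 0"
    using u by (metis (mono_tags, lifting) I_def finite_lessThan norm_zero prod_zero_iff zero_neq_one)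
  have 1: "cmod \<gamma>' = 1" using assms(1) u by (simp add: \<gamma>'_def norm_divide flip: prod_norm)
  have 2: "\<forall>i\<in>I. xs ! i \<in> ball 0 1" using xs nth_mem by (fastforce simp: I_def simp del: mem_ball)
  have 3: "summable (\<lambda>i. if i \<in> I then 1 - cmod (xs ! i) else 0)"
    by (rule summable_finite[of I]) (auto simp: I_def)
  have 4: "\<gamma> * (\<Prod>i=1..n. blaschke_factor (a i) z ^ m i) =
     \<gamma>' * (\<Prod>i. if i \<in> I then u (xs ! i) * blaschke_factor (xs ! i) z else 1)" for z
  proof -
    have "(\<Prod>i. if i \<in> I then u (xs ! i) * blaschke_factor (xs ! i) z else 1) =
       (\<Prod>i\<in>I. if i \<in> I then u (xs ! i) * blaschke_factor (xs ! i) z else 1)"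
      by (rule prodinf_finite) (auto simp: I_def)
    also have "\<dots> = (\<Prod>i\<in>I. u (xs ! i)) * (\<Prod>i\<in>I. blaschke_factor (xs ! i) z)"
      by (simp add: prod.distrib)
    also have "(\<Prod>i\<in>I. blaschke_factor (xs ! i) z) = prod_list (map (\<lambda>c. blaschke_factor c z) xs)"
      by (simp add: I_def prod.list_conv_set_nth atLeast0LessThan)
    also have "\<dots> = (\<Prod>i=1..n. blaschke_factor (a i) z ^ m i)"
      unfolding xs_def by (induction n) (auto simp: mult.commute)
    finally show ?thesis using nz by (simp add: \<gamma>'_def)
  qed
  show ?thesis
    unfolding blaschke_product_def
    by (intro exI[of _ \<gamma>'] exI[of _ I] exI[of _ "\<lambda>i. xs ! i"]) (use 1 2 3 4[unfolded u_def] in blast)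
qed

end

theory Submission
  imports Defs
begin

text \<open>
  Invariance only has to be tested on one function. The constant \<open>1\<close> lies in \<open>H\<^sup>p\<close>, hence
  \<open>\<theta>\<close> lies in \<open>\<theta> H\<^sup>p\<close>, and invariance forces \<open>\<theta> \<circ> \<phi> = \<theta> f\<close> with \<open>f\<close> holomorphic on the disk.

  Compare orders of vanishing at a zero \<open>a i\<close>. The right-hand side vanishes there to order at
  least \<open>m i\<close>. An automorphism has non-vanishing derivative, so the left-hand side vanishes there
  exactly to the order of \<open>\<theta>\<close> at \<open>\<phi> (a i)\<close>. As the singular factor has no zeros,
  \<open>\<phi> (a i)\<close> must therefore be one of the points \<open>a j\<close>, with \<open>m i \<le> m j\<close>: the map \<open>\<phi>\<close> permutes
  the zeros and does not lower multiplicities.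

  The largest multiplicity belongs to \<open>a n\<close> alone, so \<open>\<phi>\<close> fixes \<open>a n\<close>. The second largest belongs
  to \<open>a (n - 1)\<close> alone and the point \<open>a n\<close> is already taken, so by injectivity \<open>\<phi>\<close> fixes
  \<open>a (n - 1)\<close> as well. By the uniqueness part of the Schwarz lemma, a holomorphic self-map of the
  disk with two fixed points is the identity.
\<close>

section \<open>Self-maps of the disk with two fixed points\<close>

text \<open>
  Conjugation by a Moebius map moves one fixed point to the origin. The other one then shows that
  equality holds in the Schwarz lemma, so the conjugated map is a rotation; a rotation fixing a
  nonzero point is trivial.
\<close>
lemma disk_self_map_two_fixed_points:
  assumes holo: "\<phi> holomorphic_on ball 0 1" and maps: "\<phi> ` ball 0 1 \<subseteq> ball 0 1"
    and a: "a \<in> ball 0 1" "\<phi> a = a" and b: "b \<in> ball 0 1" "\<phi> b = b" and "a \<noteq> b"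
    and z: "z \<in> ball 0 1"
  shows "\<phi> z = z"
proof -
  let ?M = "Moebius_function 0"
  define \<psi> where "\<psi> = ?M a \<circ> \<phi> \<circ> ?M (-a)"
  have na: "cmod a < 1" using a by simp
  have M: "?M a ` ball 0 1 \<subseteq> ball 0 1" "?M (-a) ` ball 0 1 \<subseteq> ball 0 1"
    using na by (auto intro!: Moebius_function_norm_lt_1)
  have inv: "?M (-a) (?M a w) = w" if "w \<in> ball 0 1" for w
    using that na by (intro Moebius_function_compose) auto
  have "\<phi> \<circ> ?M (-a) holomorphic_on ball 0 1"
    using na holo M by (intro holomorphic_on_compose_gen[of _ _ _ "ball 0 1"] Moebius_function_holomorphic) auto
  then have hol\<psi>: "\<psi> holomorphic_on ball 0 1"
    unfolding \<psi>_def comp_assoc using na maps M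
    by (elim holomorphic_on_compose_gen[where t = "ball 0 1"])
      (auto intro: Moebius_function_holomorphic simp: image_subset_iff simp del: mem_ball)
  have \<psi>0: "\<psi> 0 = 0"
    using a by (simp add: \<psi>_def Moebius_function_of_zero Moebius_function_eq_zero)
  have no: "cmod (\<psi> w) < 1" if "cmod w < 1" for w
    using that maps M unfolding \<psi>_def by (force simp: image_subset_iff)
  define c where "c = ?M a b"
  have c: "cmod c < 1" using M(1) b(1) by (auto simp: c_def image_subset_iff)
  have \<psi>c: "\<psi> c = c" using inv[OF b(1)] b by (simp add: \<psi>_def c_def)
  have "c \<noteq> 0"
    using inv[OF b(1)] \<open>a \<noteq> b\<close> by (auto simp: c_def Moebius_function_of_zero)
  then have "\<exists>w. cmod w < 1 \<and> w \<noteq> 0 \<and> cmod (\<psi> w) = cmod w"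
    using \<psi>c c by auto
  then obtain \<alpha> where \<alpha>: "\<And>w. cmod w < 1 \<Longrightarrow> \<psi> w = \<alpha> * w"
    using Schwarz_Lemma(3)[OF hol\<psi> \<psi>0 no, of 0] by auto
  with \<psi>c c \<open>c \<noteq> 0\<close> have "\<alpha> = 1" by force
  have "\<phi> z = ?M (-a) (?M a (\<phi> z))" using inv[of "\<phi> z"] maps z by (simp add: image_subset_iff)
  also have "?M a (\<phi> z) = \<psi> (?M a z)" using inv[OF z] by (simp add: \<psi>_def)
  also have "\<dots> = ?M a z" using \<alpha>[of "?M a z"] \<open>\<alpha> = 1\<close> M(1) z by (simp add: image_subset_iff)
  finally show ?thesis using inv[OF z] by simp
qed

section \<open>Orders of vanishing\<close>

lemma blaschke_denominator_nonzero:
  assumes "a \<in> ball 0 1" "z \<in> ball 0 1"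
  shows "1 - cnj a * z \<noteq> 0"
proof
  assume "1 - cnj a * z = 0"
  then have "cmod a * cmod z = 1" by (metis complex_mod_cnj eq_iff_diff_eq_0 norm_mult norm_one)
  with assms show False using mult_strict_mono[of "cmod a" 1 "cmod z" 1] by auto
qed

lemma blaschke_factor_eq_0_iff:
  assumes "a \<in> ball 0 1" "z \<in> ball 0 1"
  shows "blaschke_factor a z = 0 \<longleftrightarrow> z = a"
  using blaschke_denominator_nonzero[OF assms] by (auto simp: blaschke_factor_def)

lemma blaschke_factor_holomorphic:
  assumes "a \<in> ball 0 1"
  shows "blaschke_factor a holomorphic_on ball 0 1"
  unfolding blaschke_factor_def
  by (intro holomorphic_intros) (use blaschke_denominator_nonzero[OF assms] in auto)

text \<open>
  Distinctness of the zeros keeps the cofactor nonzero at \<open>a i\<close>, so that \<open>m i\<close> is the exact order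
  of vanishing there.
\<close>
lemma finite_blaschke_product_linear_factor:
  fixes a :: "'i \<Rightarrow> complex"
  assumes "finite I" and a: "\<forall>j\<in>I. a j \<in> ball 0 1" and inj: "inj_on a I" and i: "i \<in> I"
  obtains g where "g holomorphic_on ball 0 1" "g (a i) \<noteq> 0"
    "\<And>z. (\<Prod>j\<in>I. blaschke_factor (a j) z ^ m j) = (z - a i) ^ m i * g z"
proof
  define g where "g = (\<lambda>z. (- 1 / (1 - cnj (a i) * z)) ^ m i *
    (\<Prod>j\<in>I - {i}. blaschke_factor (a j) z ^ m j))"
  have ai: "a i \<in> ball 0 1" using a i by blast
  show "g holomorphic_on ball 0 1"
    unfolding g_def
    by (intro holomorphic_intros blaschke_factor_holomorphic)
      (use a ai blaschke_denominator_nonzero in auto)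
  have "blaschke_factor (a j) (a i) \<noteq> 0" if "j \<in> I - {i}" for j
    using that a inj i by (subst blaschke_factor_eq_0_iff) (auto dest: inj_onD)
  then show "g (a i) \<noteq> 0"
    using blaschke_denominator_nonzero[OF ai ai] \<open>finite I\<close> by (auto simp: g_def)
  show "(\<Prod>j\<in>I. blaschke_factor (a j) z ^ m j) = (z - a i) ^ m i * g z" for z
  proof -
    have "blaschke_factor (a i) z = (z - a i) * (- 1 / (1 - cnj (a i) * z))"
      by (simp add: blaschke_factor_def diff_divide_distrib)
    then have "blaschke_factor (a i) z ^ m i
        = (z - a i) ^ m i * (- 1 / (1 - cnj (a i) * z)) ^ m i"
      by (metis power_mult_distrib)
    then show ?thesis
      unfolding prod.remove[OF \<open>finite I\<close> i] g_def by (simp only: mult.assoc)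
  qed
qed

text \<open>
  If \<open>l < k\<close>, dividing by \<open>(z - x) ^ l\<close> and letting \<open>z\<close> tend to \<open>x\<close> would give
  \<open>D ^ l * v x = 0\<close>.
\<close>
lemma vanishing_order_le:
  fixes \<phi> u v :: "complex \<Rightarrow> complex"
  assumes D: "(\<phi> has_field_derivative D) (at x)" "D \<noteq> 0"
    and u: "isCont u x" and v: "isCont v x" "v x \<noteq> 0"
    and eq: "\<forall>\<^sub>F z in at x. (\<phi> z - \<phi> x) ^ l * v z = (z - x) ^ k * u z"
  shows "k \<le> l"
proof (rule ccontr)
  assume "\<not> k \<le> l"
  then have kl: "k = l + (k - l)" "k - l > 0" by auto
  have lim: "((\<lambda>z. ((\<phi> z - \<phi> x) / (z - x)) ^ l * v z) \<longlongrightarrow> D ^ l * v x) (at x)"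
    using D(1) v(1) by (intro tendsto_intros) (auto simp: has_field_derivative_iff isCont_def)
  have lim': "((\<lambda>z. (z - x) ^ (k - l) * u z) \<longlongrightarrow> (x - x) ^ (k - l) * u x) (at x)"
    using u by (intro tendsto_intros) (auto simp: isCont_def)
  have "\<forall>\<^sub>F z in at x.
      ((\<phi> z - \<phi> x) / (z - x)) ^ l * v z = (z - x) ^ (k - l) * u z"
    using eq eventually_neq_at_within[of x]
  proof eventually_elim
    case (elim z)
    have "(z - x) ^ k = (z - x) ^ l * (z - x) ^ (k - l)"
      using kl(1) by (metis power_add)
    with elim show ?case by (simp add: power_divide field_simps)
  qed
  then have "D ^ l * v x = (x - x) ^ (k - l) * u x"
    using tendsto_unique[OF trivial_limit_at Lim_transform_eventually[OF lim] lim'] by simp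
  with kl(2) D v show False by (simp add: power_0_left)
qed

section \<open>Invariant subspaces and the zeros of the inner function\<close>

lemma one_in_hardy_space: "(\<lambda>_. 1) \<in> hardy_space p"
  by (auto simp: hardy_space_def)

text \<open>Applying invariance to \<open>\<theta>\<close> itself.\<close>
lemma invariant_imp_divides_composition:
  assumes "composition_op \<phi> ` mult_hardy \<theta> p \<subseteq> mult_hardy \<theta> p"
  obtains f where "f holomorphic_on ball 0 1" "\<And>z. z \<in> ball 0 1 \<Longrightarrow> \<theta> (\<phi> z) = \<theta> z * f z"
proof -
  have "\<theta> \<in> mult_hardy \<theta> p"
    unfolding mult_hardy_def using one_in_hardy_space by (intro CollectI bexI) auto
  then have "\<theta> \<circ> \<phi> \<in> mult_hardy \<theta> p"
    using assms by (auto simp: composition_op_def)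
  then show ?thesis
    using that by (auto simp: mult_hardy_def hardy_space_def)
qed

text \<open>
  At \<open>a i\<close> the function \<open>\<theta> \<circ> \<phi>\<close> vanishes because \<open>\<theta>\<close> divides it, so \<open>\<phi> (a i)\<close> is a zero of \<open>\<theta>\<close>;
  injectivity of \<open>\<phi>\<close> makes its derivative nonzero, so composition with \<open>\<phi>\<close> preserves orders.
\<close>
lemma invariant_imp_zero_mapped_to_zero:
  fixes a :: "'i \<Rightarrow> complex"
  assumes inv: "composition_op \<phi> ` mult_hardy \<theta> p \<subseteq> mult_hardy \<theta> p"
    and aut: "disk_automorphism \<phi>"
    and "finite I" and a: "\<forall>j\<in>I. a j \<in> ball 0 1" and inj: "inj_on a I"
    and m: "\<forall>j\<in>I. m j \<ge> 1" and "\<gamma> \<noteq> 0"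
    and comp: "blaschke_component \<theta> (\<lambda>z. \<gamma> * (\<Prod>j\<in>I. blaschke_factor (a j) z ^ m j))"
    and i: "i \<in> I"
  obtains j where "j \<in> I" "\<phi> (a i) = a j" "m i \<le> m j"
proof -
  obtain S where S: "S holomorphic_on ball 0 1" "\<And>z. z \<in> ball 0 1 \<Longrightarrow> S z \<noteq> 0"
    and \<theta>: "\<And>z. z \<in> ball 0 1 \<Longrightarrow> \<theta> z = \<gamma> * (\<Prod>j\<in>I. blaschke_factor (a j) z ^ m j) * S z"
    using comp unfolding blaschke_component_def singular_inner_def inner_function_def by blast
  obtain f where f: "f holomorphic_on ball 0 1"
    and \<theta>\<phi>: "\<And>z. z \<in> ball 0 1 \<Longrightarrow> \<theta> (\<phi> z) = \<theta> z * f z"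
    using invariant_imp_divides_composition[OF inv] by blast
  have hol: "\<phi> holomorphic_on ball 0 1" and inj\<phi>: "inj_on \<phi> (ball 0 1)"
    and maps: "\<And>z. z \<in> ball 0 1 \<Longrightarrow> \<phi> z \<in> ball 0 1"
    using aut unfolding disk_automorphism_def bij_betw_def by blast+
  have \<theta>_zero: "\<theta> z = 0 \<longleftrightarrow> (\<exists>j\<in>I. z = a j)" if z: "z \<in> ball 0 1" for z
  proof -
    have "blaschke_factor (a j) z ^ m j = 0 \<longleftrightarrow> z = a j" if "j \<in> I" for j
      using that m a z blaschke_factor_eq_0_iff[of "a j" z] by force
    then show ?thesis using \<theta>[OF z] S(2)[OF z] \<open>\<gamma> \<noteq> 0\<close> \<open>finite I\<close> by simp
  qed
  have ai: "a i \<in> ball 0 1" using a i by blast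
  have "\<theta> (\<phi> (a i)) = 0" using \<theta>\<phi>[OF ai] \<theta>_zero[OF ai] i by auto
  then obtain j where j: "j \<in> I" "\<phi> (a i) = a j" using \<theta>_zero[OF maps[OF ai]] by blast
  obtain g where g: "g holomorphic_on ball 0 1"
    "\<And>z. (\<Prod>j\<in>I. blaschke_factor (a j) z ^ m j) = (z - a i) ^ m i * g z"
    using finite_blaschke_product_linear_factor[OF \<open>finite I\<close> a inj i] by blast
  obtain h where h: "h holomorphic_on ball 0 1" "h (a j) \<noteq> 0"
    "\<And>z. (\<Prod>j\<in>I. blaschke_factor (a j) z ^ m j) = (z - a j) ^ m j * h z"
    using finite_blaschke_product_linear_factor[OF \<open>finite I\<close> a inj j(1)] by blast
  have cont: "isCont q (a i)" if "q holomorphic_on ball 0 1" for q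
    using that ai continuous_on_eq_continuous_at holomorphic_on_imp_continuous_on open_ball by blast
  have "m i \<le> m j"
  proof (rule vanishing_order_le)
    show "(\<phi> has_field_derivative deriv \<phi> (a i)) (at (a i))"
      using holomorphic_derivI[OF hol open_ball ai] .
    show "deriv \<phi> (a i) \<noteq> 0"
      using holomorphic_injective_imp_regular[OF hol open_ball inj\<phi> ai] .
    show "isCont (\<lambda>z. g z * S z * f z) (a i)"
      using g S f by (intro cont holomorphic_intros)
    have "(\<lambda>z. h z * S z) \<circ> \<phi> holomorphic_on ball 0 1"
      using hol h S maps by (intro holomorphic_on_compose_gen[of _ _ _ "ball 0 1"] holomorphic_intros) blast+
    then show "isCont (\<lambda>z. h (\<phi> z) * S (\<phi> z)) (a i)"
      using cont by (simp add: o_def)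
    show "h (\<phi> (a i)) * S (\<phi> (a i)) \<noteq> 0"
      using h j S(2)[OF maps[OF ai]] by simp
    have "(\<phi> z - \<phi> (a i)) ^ m j * (h (\<phi> z) * S (\<phi> z)) = (z - a i) ^ m i * (g z * S z * f z)"
      if z: "z \<in> ball 0 1" for z
      using \<theta>\<phi>[OF z] \<open>\<gamma> \<noteq> 0\<close> unfolding \<theta>[OF z] \<theta>[OF maps[OF z]] h(3)[of "\<phi> z"] g(2)[of z] j(2)
      by (simp add: mult_ac)
    then show "\<forall>\<^sub>F z in at (a i).
        (\<phi> z - \<phi> (a i)) ^ m j * (h (\<phi> z) * S (\<phi> z)) = (z - a i) ^ m i * (g z * S z * f z)"
      using eventually_at_in_open'[OF open_ball ai] by (auto elim: eventually_mono)
  qed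
  with j that show ?thesis by blast
qed

theorem theorem5p8:
  fixes p :: real and \<theta> \<phi> :: "complex \<Rightarrow> complex" and \<gamma> :: complex
    and n :: nat and a :: "nat \<Rightarrow> complex" and m :: "nat \<Rightarrow> nat"
  assumes "0 < p"
    and "inner_function \<theta>"
    and "n > 1"
    and "cmod \<gamma> = 1"
    and "\<forall>i\<in>{1..n}. a i \<in> ball 0 1"
    and "inj_on a {1..n}"
    and "\<forall>i\<in>{1..n}. m i \<ge> 1"
    and "\<forall>i\<in>{1..n}. \<forall>j\<in>{1..n}. i \<le> j \<longrightarrow> m i \<le> m j"
    and "blaschke_component \<theta> (\<lambda>z. \<gamma> * (\<Prod>i=1..n. blaschke_factor (a i) z ^ m i))"
    and "n > 2 \<longrightarrow> m (n - 2) < m (n - 1)"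
    and "m (n - 1) < m n"
    and "disk_automorphism \<phi>"
    and "\<exists>z\<in>ball 0 1. \<phi> z \<noteq> z"
  shows "\<not> composition_op \<phi> ` mult_hardy \<theta> p \<subseteq> mult_hardy \<theta> p"
proof
  assume inv: "composition_op \<phi> ` mult_hardy \<theta> p \<subseteq> mult_hardy \<theta> p"
  note aut = \<open>disk_automorphism \<phi>\<close>
  have hol: "\<phi> holomorphic_on ball 0 1" and inj: "inj_on \<phi> (ball 0 1)"
    and maps: "\<phi> ` ball 0 1 \<subseteq> ball 0 1"
    using aut by (auto simp: disk_automorphism_def bij_betw_def)
  have "\<gamma> \<noteq> 0" using \<open>cmod \<gamma> = 1\<close> by auto
  note zeros = invariant_imp_zero_mapped_to_zero[OF inv aut finite_atLeastAtMost
      \<open>\<forall>i\<in>{1..n}. a i \<in> ball 0 1\<close> \<open>inj_on a {1..n}\<close> \<open>\<forall>i\<in>{1..n}. m i \<ge> 1\<close> \<open>\<gamma> \<noteq> 0\<close>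
      \<open>blaschke_component \<theta> _\<close>]
  have idx: "n \<in> {1..n}" "n - 1 \<in> {1..n}" using \<open>n > 1\<close> by auto
  have mono: "m i \<le> m j" if "1 \<le> i" "i \<le> j" "j \<le> n" for i j
    using \<open>\<forall>i\<in>{1..n}. \<forall>j\<in>{1..n}. i \<le> j \<longrightarrow> m i \<le> m j\<close> that by auto
  have "a (n - 1) \<noteq> a n"
    using inj_onD[OF \<open>inj_on a {1..n}\<close>, of "n - 1" n] idx \<open>n > 1\<close> by auto
  have in_disk: "a n \<in> ball 0 1" "a (n - 1) \<in> ball 0 1"
    using \<open>\<forall>i\<in>{1..n}. a i \<in> ball 0 1\<close> idx by blast+
  have fix_n: "\<phi> (a n) = a n"
  proof -
    obtain j where j: "j \<in> {1..n}" "\<phi> (a n) = a j" "m n \<le> m j" using zeros[OF idx(1)] .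
    have "\<not> j \<le> n - 1"
      using mono[of j "n - 1"] j \<open>m (n - 1) < m n\<close> by auto
    with j have "j = n" by auto
    with j show ?thesis by simp
  qed
  have fix_n1: "\<phi> (a (n - 1)) = a (n - 1)"
  proof -
    obtain j where j: "j \<in> {1..n}" "\<phi> (a (n - 1)) = a j" "m (n - 1) \<le> m j" using zeros[OF idx(2)] .
    have "j \<noteq> n"
      using j fix_n inj_onD[OF inj, of "a (n - 1)" "a n"] in_disk \<open>a (n - 1) \<noteq> a n\<close> by auto
    \<comment> \<open>For \<open>n = 2\<close> there is no index below \<open>n - 1\<close>, so the gap condition is then void.\<close>
    moreover have "\<not> j \<le> n - 2"
      using mono[of j "n - 2"] j \<open>n > 2 \<longrightarrow> m (n - 2) < m (n - 1)\<close> by auto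
    ultimately have "j = n - 1" using j by auto
    with j show ?thesis by simp
  qed
  have "\<phi> z = z" if "z \<in> ball 0 1" for z
    using disk_self_map_two_fixed_points[OF hol maps in_disk(2) fix_n1 in_disk(1) fix_n
        \<open>a (n - 1) \<noteq> a n\<close> that] .
  with \<open>\<exists>z\<in>ball 0 1. \<phi> z \<noteq> z\<close> show False by blast
qed

end
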